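(* Let $\alpha>0$, $\rho>0$, $\beta,\eta,\kappa\in\mathbb{R}$, $x>0$, and let $p,q>1$ satisfy $\frac1p+\frac1q=1$. Let $c\in\mathbb{R}$ and let $f,g\in X_c^p(0,x)$ be two positive functions on $[0,\infty)$. Write $I\varphi={}^{\rho}\mathcal{I}_{\eta,\kappa}^{\alpha,\beta}\varphi(x)$, and assume that the fractional integrals appearing below exist (as finite integrals). Then the following inequalities hold: 1. $\displaystyle \frac{I(f^p)\,I(g^2)}{p}+\frac{I(f^2)\,I(g^q)}{q}\ \ge\ I(fg)\,I\bigl(f^{2/q}g^{2/p}\bigr).$ 2. $\displaystyle \frac{I(f^2)\,I(g^q)}{p}+\frac{I(f^p)\,I(g^2)}{q}\ \ge\ I\bigl(f^{2/p}g^{2/q}\bigr)\,I\bigl(f^{p-1}g^{q-1}\bigr).$ 3. $\displaystyle I(f^2)\,I\!\left(\frac{g^p}{p}+\frac{g^q}{q}\right)\ \ge\ I\bigl(f^{2/p}g\bigr)\,I\bigl(f^{2/q}g\bigr).$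
   Context: For a function $\varphi$ on $[0,\infty)$, the (left-sided, based at $0$) Katugampola fractional integral is $${}^{\rho}\mathcal{I}_{\eta,\kappa}^{\alpha,\beta}\varphi(x)=\frac{\rho^{1-\beta}x^{\kappa}}{\Gamma(\alpha)}\int_{0}^{x}\frac{\tau^{\rho(\eta+1)-1}}{(x^{\rho}-\tau^{\rho})^{1-\alpha}}\varphi(\tau)\,d\tau,\qquad x>0,$$ whenever the integral exists. For $c\in\mathbb{R}$ and $1\le p<\infty$, $X_c^p(a,b)$ is the space of complex-valued Lebesgue measurable functions $\varphi$ on $(a,b)$ with $\|\varphi\|_{X_c^p}=\left(\int_a^b|t^c\varphi(t)|^p\frac{dt}{t}\right)^{1/p}<\infty$. Powers and products of functions are pointwise. *)

theory Defs
  imports "HOL-Analysis.Analysis"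
begin

definition katugampola_kernel :: "real \<Rightarrow> real \<Rightarrow> real \<Rightarrow> real \<Rightarrow> real \<Rightarrow> real" where
  "katugampola_kernel \<rho> \<alpha> \<eta> x \<tau> =
     \<tau> powr (\<rho> * (\<eta> + 1) - 1) / (x powr \<rho> - \<tau> powr \<rho>) powr (1 - \<alpha>)"

text \<open>
  Existence of the integral is existence as a finite Lebesgue integral. It is a separate
  predicate because the Bochner integral of a non-integrable function is 0.
\<close>

definition katugampola_exists ::
    "real \<Rightarrow> real \<Rightarrow> real \<Rightarrow> (real \<Rightarrow> real) \<Rightarrow> real \<Rightarrow> bool" where
  "katugampola_exists \<rho> \<alpha> \<eta> \<phi> x \<longleftrightarrow>
     set_integrable lebesgue {0<..<x} (\<lambda>\<tau>. katugampola_kernel \<rho> \<alpha> \<eta> x \<tau> * \<phi> \<tau>)"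

definition katugampola ::
    "real \<Rightarrow> real \<Rightarrow> real \<Rightarrow> real \<Rightarrow> real \<Rightarrow> (real \<Rightarrow> real) \<Rightarrow> real \<Rightarrow> real" where
  "katugampola \<rho> \<alpha> \<beta> \<eta> \<kappa> \<phi> x =
     \<rho> powr (1 - \<beta>) * x powr \<kappa> / Gamma \<alpha> *
       (LINT \<tau>:{0<..<x}|lebesgue. katugampola_kernel \<rho> \<alpha> \<eta> x \<tau> * \<phi> \<tau>)"

text \<open>
  The space \<open>X\<^sub>c\<^sup>p(a,b)\<close> for \<open>0 \<le> a\<close>. The norm is the \<open>p\<close>-th root of the integral below, so it
  is finite exactly when the integral is.
\<close>

definition Xcp :: "real \<Rightarrow> real \<Rightarrow> real \<Rightarrow> real \<Rightarrow> (real \<Rightarrow> complex) set" where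
  "Xcp c p a b =
     {\<phi>. \<phi> \<in> borel_measurable (lebesgue_on {a<..<b}) \<and>
         (\<integral>\<^sup>+t. ennreal (cmod (complex_of_real (t powr c) * \<phi> t) powr p / t)
            \<partial>lebesgue_on {a<..<b}) < \<infinity>}"

end

theory Submission
  imports Defs
begin

text \<open>
  Each inequality is Young's inequality \<open>a b \<le> a\<^sup>p / p + b\<^sup>q / q\<close> with \<open>a\<close>, \<open>b\<close> built from the
  values of \<open>f\<close> and \<open>g\<close> at two independent points \<open>s\<close>, \<open>t\<close>, so that both sides become sums of
  products of a function of \<open>s\<close> and a function of \<open>t\<close>. Integrating against the nonnegative kernel
  in \<open>s\<close> and then in \<open>t\<close> turns such a pointwise bound into one between products of integrals.
\<close>

text \<open>With \<open>t\<close> fixed, \<open>H t\<close>, \<open>V t\<close> and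
  \<open>Z t\<close> are constants, so integrating in \<open>s\<close> leaves a bound that is again
  linear in these three values; integrating it in \<open>t\<close> gives the claim. Only iterated
  integrals of single-variable functions occur, never an integral over the product space.\<close>

lemma set_integral_mult_le:
  fixes E H U V W Z :: "'a \<Rightarrow> real"
  assumes int: "set_integrable M A E" "set_integrable M A H" "set_integrable M A U"
      "set_integrable M A V" "set_integrable M A W" "set_integrable M A Z"
    and le: "\<And>s t. s \<in> A \<Longrightarrow> t \<in> A \<Longrightarrow> E s * H t \<le> a * (U s * V t) + b * (W s * Z t)"
  shows "(LINT s:A|M. E s) * (LINT t:A|M. H t)
    \<le> a * ((LINT s:A|M. U s) * (LINT t:A|M. V t)) + b * ((LINT s:A|M. W s) * (LINT t:A|M. Z t))"
proof -
  have inner: "(LINT s:A|M. E s) * H t \<le> a * (LINT s:A|M. U s) * V t + b * (LINT s:A|M. W s) * Z t"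
    if t: "t \<in> A" for t
  proof -
    have i: "set_integrable M A (\<lambda>s. (a * V t) * U s)" "set_integrable M A (\<lambda>s. (b * Z t) * W s)"
      using int by (auto intro!: set_integrable_mult_right)
    have "(LINT s:A|M. E s * H t) \<le> (LINT s:A|M. (a * V t) * U s + (b * Z t) * W s)"
      using int le t
      by (intro set_integral_mono set_integrable_mult_left set_integral_add i) (auto simp: mult_ac)
    also have "\<dots> = (LINT s:A|M. (a * V t) * U s) + (LINT s:A|M. (b * Z t) * W s)"
      by (rule set_integral_add(2)[OF i])
    finally show ?thesis
      unfolding set_integral_mult_left set_integral_mult_right by (simp only: mult_ac)
  qed
  have i: "set_integrable M A (\<lambda>t. a * (LINT s:A|M. U s) * V t)"
      "set_integrable M A (\<lambda>t. b * (LINT s:A|M. W s) * Z t)"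
    using int by (auto intro!: set_integrable_mult_right)
  have "(LINT t:A|M. (LINT s:A|M. E s) * H t)
      \<le> (LINT t:A|M. a * (LINT s:A|M. U s) * V t + b * (LINT s:A|M. W s) * Z t)"
    using int inner by (intro set_integral_mono set_integrable_mult_right set_integral_add i)
  also have "\<dots> = (LINT t:A|M. a * (LINT s:A|M. U s) * V t)
      + (LINT t:A|M. b * (LINT s:A|M. W s) * Z t)"
    by (rule set_integral_add(2)[OF i])
  finally show ?thesis
    unfolding set_integral_mult_right by (simp only: mult_ac)
qed

lemma katugampola_kernel_nonneg: "katugampola_kernel \<rho> \<alpha> \<eta> x \<tau> \<ge> 0"
  by (simp add: katugampola_kernel_def)

lemma katugampola_mult_le:
  assumes ex: "katugampola_exists \<rho> \<alpha> \<eta> e x" "katugampola_exists \<rho> \<alpha> \<eta> h x"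
      "katugampola_exists \<rho> \<alpha> \<eta> u x" "katugampola_exists \<rho> \<alpha> \<eta> v x"
      "katugampola_exists \<rho> \<alpha> \<eta> w x" "katugampola_exists \<rho> \<alpha> \<eta> z x"
    and le: "\<And>s t. \<lbrakk>0 < s; s < x; 0 < t; t < x\<rbrakk> \<Longrightarrow> e s * h t \<le> u s * v t / p + w s * z t / q"
  shows "katugampola \<rho> \<alpha> \<beta> \<eta> \<kappa> e x * katugampola \<rho> \<alpha> \<beta> \<eta> \<kappa> h x
    \<le> katugampola \<rho> \<alpha> \<beta> \<eta> \<kappa> u x * katugampola \<rho> \<alpha> \<beta> \<eta> \<kappa> v x / p
      + katugampola \<rho> \<alpha> \<beta> \<eta> \<kappa> w x * katugampola \<rho> \<alpha> \<beta> \<eta> \<kappa> z x / q"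
proof -
  define k where "k = katugampola_kernel \<rho> \<alpha> \<eta> x"
  define C where "C = \<rho> powr (1 - \<beta>) * x powr \<kappa> / Gamma \<alpha>"
  define J where "J \<phi> = (LINT \<tau>:{0<..<x}|lebesgue. k \<tau> * \<phi> \<tau>)" for \<phi>
  have K: "katugampola \<rho> \<alpha> \<beta> \<eta> \<kappa> \<phi> x = C * J \<phi>" for \<phi>
    by (simp add: katugampola_def C_def J_def k_def)
  have "J e * J h \<le> 1 / p * (J u * J v) + 1 / q * (J w * J z)"
    unfolding J_def
  proof (rule set_integral_mult_le)
    fix s t assume "s \<in> {0<..<x}" "t \<in> {0<..<x}"
    then have "k s * k t * (e s * h t) \<le> k s * k t * (u s * v t / p + w s * z t / q)"
      using le katugampola_kernel_nonneg by (intro mult_left_mono) (auto simp: k_def)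
    then show "k s * e s * (k t * h t)
        \<le> 1 / p * (k s * u s * (k t * v t)) + 1 / q * (k s * w s * (k t * z t))"
      by (simp add: algebra_simps)
  qed (use ex in \<open>auto simp: katugampola_exists_def k_def\<close>)
  \<comment> \<open>Every term is a product of two fractional integrals and so carries the prefactor
    \<open>C\<close> twice. Its square is nonnegative whatever the sign of
    \<open>Gamma \<alpha>\<close>.\<close>
  then have "C\<^sup>2 * (J e * J h) \<le> C\<^sup>2 * (1 / p * (J u * J v) + 1 / q * (J w * J z))"
    by (rule mult_left_mono) simp
  then show ?thesis
    by (simp add: K power2_eq_square algebra_simps)
qed

lemma katugampola_add:
  assumes "katugampola_exists \<rho> \<alpha> \<eta> u x" "katugampola_exists \<rho> \<alpha> \<eta> v x"
  shows "katugampola \<rho> \<alpha> \<beta> \<eta> \<kappa> (\<lambda>t. u t / p + v t / q) x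
    = katugampola \<rho> \<alpha> \<beta> \<eta> \<kappa> u x / p + katugampola \<rho> \<alpha> \<beta> \<eta> \<kappa> v x / q"
proof -
  let ?k = "katugampola_kernel \<rho> \<alpha> \<eta> x"
  have "(LINT t:{0<..<x}|lebesgue. ?k t * (u t / p + v t / q))
      = (LINT t:{0<..<x}|lebesgue. (1 / p) * (?k t * u t) + (1 / q) * (?k t * v t))"
    by (simp add: algebra_simps)
  also have "\<dots> = (LINT t:{0<..<x}|lebesgue. (1 / p) * (?k t * u t))
      + (LINT t:{0<..<x}|lebesgue. (1 / q) * (?k t * v t))"
    using assms unfolding katugampola_exists_def
    by (intro set_integral_add(2) set_integrable_mult_right)
  finally show ?thesis
    unfolding set_integral_mult_right by (simp add: katugampola_def algebra_simps)
qed

text \<open>Existence by domination: the nonnegative kernel preserves the pointwise bound.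
  Measurability of \<open>u\<close> has to be supplied, since a bound does not give it.\<close>

lemma katugampola_exists_bound:
  assumes ex: "katugampola_exists \<rho> \<alpha> \<eta> v x"
    and meas: "u \<in> borel_measurable (lebesgue_on {0<..<x})"
    and le: "\<And>t. \<lbrakk>0 < t; t < x\<rbrakk> \<Longrightarrow> \<bar>u t\<bar> \<le> \<bar>v t\<bar>"
  shows "katugampola_exists \<rho> \<alpha> \<eta> u x"
  unfolding katugampola_exists_def
proof (rule set_integrable_bound[OF ex[unfolded katugampola_exists_def]])
  have "katugampola_kernel \<rho> \<alpha> \<eta> x \<in> borel_measurable (lebesgue_on {0<..<x})"
    unfolding katugampola_kernel_def[abs_def]
    by (intro measurable_restrict_space1 measurable_completion) measurable
  then have "(\<lambda>t. katugampola_kernel \<rho> \<alpha> \<eta> x t * u t) \<in> borel_measurable (lebesgue_on {0<..<x})"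
    using meas by measurable
  then show "set_borel_measurable lebesgue {0<..<x} (\<lambda>t. katugampola_kernel \<rho> \<alpha> \<eta> x t * u t)"
    by (simp add: set_borel_measurable_def borel_measurable_restrict_space_iff)
next
  show "AE t in lebesgue. t \<in> {0<..<x} \<longrightarrow> norm (katugampola_kernel \<rho> \<alpha> \<eta> x t * u t)
      \<le> norm (katugampola_kernel \<rho> \<alpha> \<eta> x t * v t)"
    using le by (auto simp: abs_mult intro!: mult_left_mono)
qed

text \<open>Membership in \<open>Xcp\<close> serves here as the source of measurability for the
  domination argument.\<close>

lemma Xcp_of_real_measurable:
  assumes "(\<lambda>t. complex_of_real (u t)) \<in> Xcp c p a b"
  shows "u \<in> borel_measurable (lebesgue_on {a<..<b})"
proof -
  have "(\<lambda>t. complex_of_real (u t)) \<in> borel_measurable (lebesgue_on {a<..<b})"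
    using assms by (simp add: Xcp_def)
  then have "(\<lambda>t. Re (complex_of_real (u t))) \<in> borel_measurable (lebesgue_on {a<..<b})"
    by (rule borel_measurable_Re[THEN measurable_compose[rotated]])
  then show ?thesis
    by simp
qed

theorem theorem4:
  fixes \<alpha> \<rho> \<beta> \<eta> \<kappa> x p q c :: real
    and f g :: "real \<Rightarrow> real"
    and I :: "(real \<Rightarrow> real) \<Rightarrow> real"
    and ex :: "(real \<Rightarrow> real) \<Rightarrow> bool"
  defines "I \<equiv> \<lambda>\<phi>. katugampola \<rho> \<alpha> \<beta> \<eta> \<kappa> \<phi> x"
    and "ex \<equiv> \<lambda>\<phi>. katugampola_exists \<rho> \<alpha> \<eta> \<phi> x"
  assumes "\<alpha> > 0" and "\<rho> > 0" and "x > 0"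
    and "p > 1" and "q > 1" and "1 / p + 1 / q = 1"
    and "(\<lambda>t. complex_of_real (f t)) \<in> Xcp c p 0 x"
    and "(\<lambda>t. complex_of_real (g t)) \<in> Xcp c p 0 x"
    and "\<And>t. t \<ge> 0 \<Longrightarrow> f t > 0"
    and "\<And>t. t \<ge> 0 \<Longrightarrow> g t > 0"
    and "ex (\<lambda>t. f t powr p)"
    and "ex (\<lambda>t. (g t)\<^sup>2)"
    and "ex (\<lambda>t. (f t)\<^sup>2)"
    and "ex (\<lambda>t. g t powr q)"
    and "ex (\<lambda>t. f t * g t)"
    and "ex (\<lambda>t. f t powr (2 / q) * g t powr (2 / p))"
    and "ex (\<lambda>t. f t powr (2 / p) * g t powr (2 / q))"
    and "ex (\<lambda>t. f t powr (p - 1) * g t powr (q - 1))"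
    and "ex (\<lambda>t. g t powr p / p + g t powr q / q)"
    and "ex (\<lambda>t. f t powr (2 / p) * g t)"
    and "ex (\<lambda>t. f t powr (2 / q) * g t)"
  shows "I (\<lambda>t. f t powr p) * I (\<lambda>t. (g t)\<^sup>2) / p + I (\<lambda>t. (f t)\<^sup>2) * I (\<lambda>t. g t powr q) / q
           \<ge> I (\<lambda>t. f t * g t) * I (\<lambda>t. f t powr (2 / q) * g t powr (2 / p))
       \<and> I (\<lambda>t. (f t)\<^sup>2) * I (\<lambda>t. g t powr q) / p + I (\<lambda>t. f t powr p) * I (\<lambda>t. (g t)\<^sup>2) / q
           \<ge> I (\<lambda>t. f t powr (2 / p) * g t powr (2 / q)) * I (\<lambda>t. f t powr (p - 1) * g t powr (q - 1))
       \<and> I (\<lambda>t. (f t)\<^sup>2) * I (\<lambda>t. g t powr p / p + g t powr q / q)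
           \<ge> I (\<lambda>t. f t powr (2 / p) * g t) * I (\<lambda>t. f t powr (2 / q) * g t)"
proof -
  have p: "p > 1" and q: "q > 1" and pq: "1 / p + 1 / q = 1" by fact+
  have conj: "q / p = q - 1" "p / q = p - 1"
    using p q pq by (auto simp: field_simps)
  have fpos: "f t > 0" and gpos: "g t > 0" if "t > 0" for t
    using assms(11)[of t] assms(12)[of t] that by auto
  note ex = assms(13-23)[unfolded ex_def]
  have gmeas: "g \<in> borel_measurable (lebesgue_on {0<..<x})"
    by (rule Xcp_of_real_measurable) fact
  \<comment> \<open>The existence of I(g^p) is not among the assumptions, only that of I(g^p/p +
    g^q/q). Both summands are nonnegative, so the first is dominated by the sum; the nonzero factor
    1/p is then removed.\<close>
  have "katugampola_exists \<rho> \<alpha> \<eta> (\<lambda>t. g t powr p / p) x"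
  proof (rule katugampola_exists_bound[OF ex(9)])
    show "(\<lambda>t. g t powr p / p) \<in> borel_measurable (lebesgue_on {0<..<x})"
      using gmeas by measurable
  qed (use p q in simp)
  then have ex_gp: "katugampola_exists \<rho> \<alpha> \<eta> (\<lambda>t. g t powr p) x"
    using p set_integrable_mult_right_iff[of "1 / p" lebesgue "{0<..<x}"]
    by (simp add: katugampola_exists_def)
  have I_sum: "I (\<lambda>t. g t powr p / p + g t powr q / q)
      = I (\<lambda>t. g t powr p) / p + I (\<lambda>t. g t powr q) / q"
    unfolding I_def by (rule katugampola_add[OF ex_gp ex(4)])
  note Young = Youngs_inequality[OF p q pq]

  have "I (\<lambda>t. f t * g t) * I (\<lambda>t. f t powr (2 / q) * g t powr (2 / p))
      \<le> I (\<lambda>t. f t powr p) * I (\<lambda>t. (g t)\<^sup>2) / p + I (\<lambda>t. g t powr q) * I (\<lambda>t. (f t)\<^sup>2) / q"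
    unfolding I_def
  proof (rule katugampola_mult_le)
    fix s t :: real assume "0 < s" "0 < t"
    with fpos gpos have pos: "f s > 0" "g s > 0" "f t > 0" "g t > 0" by auto
    \<comment> \<open>Young with a = f(s) g(t)^(2/p) and b = g(s) f(t)^(2/q): the exponents 2/p and
      2/q become squares in a^p and b^q, while in ab the factors regroup by the points s and
      t.\<close>
    show "f s * g s * (f t powr (2 / q) * g t powr (2 / p))
        \<le> f s powr p * (g t)\<^sup>2 / p + g s powr q * (f t)\<^sup>2 / q"
      using Young[of "f s * g t powr (2 / p)" "g s * f t powr (2 / q)"] pos p q
      by (simp add: powr_mult powr_powr mult_ac)
  qed (use ex in auto)
  moreover
  have "I (\<lambda>t. f t powr (2 / p) * g t powr (2 / q)) * I (\<lambda>t. f t powr (p - 1) * g t powr (q - 1))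
      \<le> I (\<lambda>t. (f t)\<^sup>2) * I (\<lambda>t. g t powr q) / p + I (\<lambda>t. (g t)\<^sup>2) * I (\<lambda>t. f t powr p) / q"
    unfolding I_def
  proof (rule katugampola_mult_le)
    fix s t :: real assume "0 < s" "0 < t"
    with fpos gpos have pos: "f s > 0" "g s > 0" "f t > 0" "g t > 0" by auto
    \<comment> \<open>Now the squares sit at s: a = f(s)^(2/p) g(t)^(q/p) and b = g(s)^(2/q)
      f(t)^(p/q). The exponents at t yield g(t)^q in a^p and f(t)^p in b^q, and in ab they are q-1
      and p-1, because p and q are conjugate.\<close>
    show "f s powr (2 / p) * g s powr (2 / q) * (f t powr (p - 1) * g t powr (q - 1))
        \<le> (f s)\<^sup>2 * g t powr q / p + (g s)\<^sup>2 * f t powr p / q"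
      using Young[of "f s powr (2 / p) * g t powr (q / p)" "g s powr (2 / q) * f t powr (p / q)"]
        pos p q
      by (simp add: powr_mult powr_powr mult_ac flip: conj)
  qed (use ex in auto)
  moreover
  have "I (\<lambda>t. f t powr (2 / p) * g t) * I (\<lambda>t. f t powr (2 / q) * g t)
      \<le> I (\<lambda>t. (f t)\<^sup>2) * I (\<lambda>t. g t powr p) / p + I (\<lambda>t. g t powr q) * I (\<lambda>t. (f t)\<^sup>2) / q"
    unfolding I_def
  proof (rule katugampola_mult_le)
    fix s t :: real assume "0 < s" "0 < t"
    with fpos gpos have pos: "f s > 0" "g s > 0" "f t > 0" "g t > 0" by auto
    \<comment> \<open>With a = f(s)^(2/p) g(t) and b = g(s) f(t)^(2/q), both a^p and b^q contain the
      square of f, once at s and once at t. After integration I(f^2) is therefore a common factor,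
      and \<open>I_sum\<close> merges I(g^p)/p and I(g^q)/q.\<close>
    show "f s powr (2 / p) * g s * (f t powr (2 / q) * g t)
        \<le> (f s)\<^sup>2 * g t powr p / p + g s powr q * (f t)\<^sup>2 / q"
      using Young[of "f s powr (2 / p) * g t" "g s * f t powr (2 / q)"] pos p q
      by (simp add: powr_mult powr_powr mult_ac)
  qed (use ex ex_gp in auto)
  ultimately show ?thesis
    by (simp add: I_sum distrib_left mult.commute)
qed

end
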